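(* Let $G$ be a labelled unit interval graph with associated sequences $(m_i)$ and $(w_i)$, and let $k\ge 1$. Then the following hold. (a) Suppose $i<|G|$ is a vertex such that $m_i+1\le m_{i+1}$, and $(w_{m_i+1},m_{m_i+1})=\cdots=(w_{m_i+k},m_{m_i+k})$ (where $m_i+k\le |G|$). For $0\le j\le k$ let $G_j=G+\{ib\mid m_i+1\le b\le m_i+j\}$. Then $(X_{G_j})_{j=0}^k$ is an arithmetic progression. In particular, if $G_0$ and $G_k$ are $e$-positive, then so is every $G_j$ for $0\le j\le k$. (b) Suppose $i>1$ is a vertex such that $w_i-1\ge w_{i-1}$, and $(w_{w_i-1},m_{w_i-1})=\cdots=(w_{w_i-k},m_{w_i-k})$ (where $w_i-k\ge 1$). For $0\le j\le k$ let $G_j=G+\{bi\mid w_i-1\ge b\ge w_i-j\}$. Then $(X_{G_j})_{j=0}^k$ is an arithmetic progression. In particular, if $G_0$ and $G_k$ are $e$-positive, then so is every $G_j$ for $0\le j\le k$.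
   Context: All graphs are finite and simple with nonempty vertex set; $|G|$ is the number of vertices. A labelled graph on $d$ vertices is a graph with vertex set $[d]=\{1,\dots,d\}$. A labelled unit interval graph is a labelled graph $G$ such that whenever $i\le v<w\le j$ and $ij\in E(G)$, also $vw\in E(G)$. For such $G$, with $N[i]$ the closed neighbourhood of $i$ (the neighbours of $i$ together with $i$), $m_i$ is the largest label in $N[i]$ and $w_i$ is the smallest label in $N[i]$; all $m$'s and $w$'s in the claim refer to the graph $G$. For a set $S$ of edges, $G+S$ is $G$ with the edges in $S$ added. The chromatic symmetric function is $X_G=\sum_\kappa \prod_{v\in V(G)}x_{\kappa(v)}$ (commuting variables), summed over all proper colourings $\kappa:V(G)\to\mathbb Z_{>0}$. With $e_i=\sum_{j_1<\cdots<j_i}x_{j_1}\cdots x_{j_i}$ and $e_\lambda=\prod_i e_{\lambda_i}$, a graph $G$ is $e$-positive if $X_G$ expands in the basis $\{e_\lambda\}$ of symmetric functions over $\mathbb Q$ with all coefficients nonnegative. *)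

theory Defs
  imports Complex_Main "HOL-Library.Poly_Mapping" "HOL-Library.Multiset" "HOL-Library.FuncSet"
begin

text \<open>
  A monomial in countably many variables is an exponent vector \<open>nat \<Rightarrow>\<^sub>0 nat\<close>, and a power series is identified with its
  coefficient function.  The variables used below are \<open>x\<^sub>1, x\<^sub>2, \<dots>\<close>; the index \<open>0\<close> never occurs.
\<close>

type_synonym monom = "nat \<Rightarrow>\<^sub>0 nat"

typedef mpseries = "UNIV :: (monom \<Rightarrow> rat) set"
  morphisms mcoeff Abs_mpseries by simp

setup_lifting type_definition_mpseries

lemma mpseries_eqI: "(\<And>m. mcoeff f m = mcoeff g m) \<Longrightarrow> f = g"
  by transfer auto

definition splits :: "monom \<Rightarrow> (monom \<times> monom) set" where
  "splits m = {(a, b). a + b = m}"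

lemma finite_splits: "finite (splits m)"
proof -
  let ?S = "{f. \<forall>x. (x \<in> Poly_Mapping.keys m \<longrightarrow> f x \<in> {..Max (range (Poly_Mapping.lookup m))})
              \<and> (x \<notin> Poly_Mapping.keys m \<longrightarrow> f x = (0::nat))}"
  have fin: "finite ?S"
    by (rule finite_set_of_finite_funs) simp_all
  have "range (Poly_Mapping.lookup m) \<subseteq> insert 0 (Poly_Mapping.lookup m ` Poly_Mapping.keys m)"
    by (auto simp: in_keys_iff image_iff)
  then have fr: "finite (range (Poly_Mapping.lookup m))"
    by (rule finite_subset) simp
  have sub: "Poly_Mapping.lookup ` fst ` splits m \<subseteq> ?S"
  proof clarsimp
    fix a b x assume "(a, b) \<in> splits m"
    then have le: "Poly_Mapping.lookup a x \<le> Poly_Mapping.lookup m x" for x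
      by (auto simp: splits_def lookup_add)
    have "Poly_Mapping.lookup m x \<le> Max (range (Poly_Mapping.lookup m))"
      using fr by (intro Max_ge) auto
    then show "(x \<in> Poly_Mapping.keys m \<longrightarrow> Poly_Mapping.lookup a x \<le> Max (range (Poly_Mapping.lookup m))) \<and>
               (x \<notin> Poly_Mapping.keys m \<longrightarrow> Poly_Mapping.lookup a x = 0)"
      using le[of x] by (auto simp: in_keys_iff)
  qed
  have "inj_on (\<lambda>p. Poly_Mapping.lookup (fst p)) (splits m)"
    by (auto simp: inj_on_def splits_def)
  then show ?thesis
    using finite_subset[OF sub fin] finite_imageD[of "\<lambda>p. Poly_Mapping.lookup (fst p)" "splits m"]
    by (simp add: image_image)
qed

instantiation mpseries :: comm_ring_1
begin

lift_definition zero_mpseries :: mpseries is "\<lambda>_. 0" .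
lift_definition one_mpseries :: mpseries is "\<lambda>m. if m = 0 then 1 else 0" .
lift_definition plus_mpseries :: "mpseries \<Rightarrow> mpseries \<Rightarrow> mpseries" is "\<lambda>f g m. f m + g m" .
lift_definition minus_mpseries :: "mpseries \<Rightarrow> mpseries \<Rightarrow> mpseries" is "\<lambda>f g m. f m - g m" .
lift_definition uminus_mpseries :: "mpseries \<Rightarrow> mpseries" is "\<lambda>f m. - f m" .
lift_definition times_mpseries :: "mpseries \<Rightarrow> mpseries \<Rightarrow> mpseries" is
  "\<lambda>f g m. \<Sum>(a, b)\<in>splits m. f a * g b" .

instance
proof
  fix f g h :: mpseries
  show "f * g * h = f * (g * h)"
  proof transfer
    fix f g h :: "monom \<Rightarrow> rat"
    have "(\<Sum>(a, b)\<in>splits m. (\<Sum>(a, b)\<in>splits a. f a * g b) * h b) =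
          (\<Sum>(a, b)\<in>splits m. f a * (\<Sum>(a, b)\<in>splits b. g a * h b))" for m
    proof -
      have "(\<Sum>(a, b)\<in>splits m. (\<Sum>(a, b)\<in>splits a. f a * g b) * h b) =
            (\<Sum>p\<in>splits m. \<Sum>q\<in>splits (fst p). f (fst q) * g (snd q) * h (snd p))"
        by (simp add: sum_distrib_right case_prod_unfold)
      also have "\<dots> = (\<Sum>(p, q)\<in>Sigma (splits m) (\<lambda>p. splits (fst p)).
                        f (fst q) * g (snd q) * h (snd p))"
        by (rule sum.Sigma) (auto intro: finite_splits)
      also have "\<dots> = (\<Sum>(p, q)\<in>Sigma (splits m) (\<lambda>p. splits (snd p)).
                        f (fst p) * (g (fst q) * h (snd q)))"
        by (rule sum.reindex_bij_witness
            [where i = "\<lambda>(p, q). ((fst p + fst q, snd q), (fst p, fst q))"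
               and j = "\<lambda>(p, q). ((fst q, snd q + snd p), (snd q, snd p))"])
           (auto simp: splits_def add.assoc mult.assoc)
      also have "\<dots> = (\<Sum>p\<in>splits m. \<Sum>q\<in>splits (snd p). f (fst p) * (g (fst q) * h (snd q)))"
        by (rule sum.Sigma[symmetric]) (auto intro: finite_splits)
      finally show ?thesis
        by (simp add: sum_distrib_left case_prod_unfold)
    qed
    then show "(\<lambda>m. \<Sum>(a, b)\<in>splits m. (\<Sum>(a, b)\<in>splits a. f a * g b) * h b) =
               (\<lambda>m. \<Sum>(a, b)\<in>splits m. f a * (\<Sum>(a, b)\<in>splits b. g a * h b))"
      by (rule ext)
  qed
  show "f * g = g * f"
  proof transfer
    fix f g :: "monom \<Rightarrow> rat"
    have "(\<Sum>(a, b)\<in>splits m. f a * g b) = (\<Sum>(a, b)\<in>splits m. g a * f b)" for m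
      by (rule sum.reindex_bij_witness[where i = prod.swap and j = prod.swap])
         (auto simp: splits_def add.commute mult.commute)
    then show "(\<lambda>m. \<Sum>(a, b)\<in>splits m. f a * g b) = (\<lambda>m. \<Sum>(a, b)\<in>splits m. g a * f b)"
      by (rule ext)
  qed
  show "1 * f = f"
  proof transfer
    fix f :: "monom \<Rightarrow> rat"
    have "(\<Sum>(a, b)\<in>splits m. (if a = 0 then 1 else 0) * f b) = f m" for m
    proof -
      have "(\<Sum>(a, b)\<in>splits m. (if a = 0 then 1 else 0) * f b) =
            (\<Sum>(a, b)\<in>{(0 :: monom, m)}. (if a = 0 then 1 else 0) * f b)"
        by (rule sum.mono_neutral_right) (auto simp: finite_splits, auto simp: splits_def split: if_splits)
      then show ?thesis by simp
    qed
    then show "(\<lambda>m. \<Sum>(a, b)\<in>splits m. (if a = 0 then 1 else 0) * f b) = f"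
      by (rule ext)
  qed
  show "(f + g) * h = f * h + g * h"
    by transfer (simp add: distrib_right sum.distrib case_prod_unfold)
  show "(0 :: mpseries) \<noteq> 1"
    by transfer (metis zero_neq_one)
qed (transfer; simp add: fun_eq_iff algebra_simps)+

end

lift_definition mconst :: "rat \<Rightarrow> mpseries" is "\<lambda>c m. if m = 0 then c else 0" .

text \<open>
  The formal sum of the monomials \<open>mon a\<close> over all \<open>a \<in> A\<close>, where \<open>A\<close> may be infinite.  This makes
  sense when every monomial has a finite fibre (see \<open>finite_fibres_chromatic_sym\<close> and \<open>finite_fibres_elem_sym\<close>).
\<close>

definition monomial_sum :: "'a set \<Rightarrow> ('a \<Rightarrow> monom) \<Rightarrow> mpseries" where
  "monomial_sum A mon = Abs_mpseries (\<lambda>m. of_nat (card {a \<in> A. mon a = m}))"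

lemma mcoeff_monomial_sum: "mcoeff (monomial_sum A mon) m = of_nat (card {a \<in> A. mon a = m})"
  by (simp add: monomial_sum_def Abs_mpseries_inverse)

text \<open>\<open>var_prod I f\<close> is the exponent vector of the monomial \<open>\<Prod>i\<in>I. x\<^bsub>f i\<^esub>\<close>.\<close>

definition var_prod :: "'a set \<Rightarrow> ('a \<Rightarrow> nat) \<Rightarrow> monom" where
  "var_prod I f = (\<Sum>i\<in>I. Poly_Mapping.single (f i) 1)"

definition elem_index_sets :: "nat \<Rightarrow> nat set set" where
  "elem_index_sets i = {J. finite J \<and> card J = i \<and> J \<subseteq> {1..}}"

definition elem_sym :: "nat \<Rightarrow> mpseries" where
  "elem_sym i = monomial_sum (elem_index_sets i) (\<lambda>J. var_prod J id)"

text \<open>An integer partition is the multiset of its (positive) parts.\<close>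

definition is_partition :: "nat multiset \<Rightarrow> bool" where
  "is_partition p \<longleftrightarrow> 0 \<notin># p"

definition elem_sym_part :: "nat multiset \<Rightarrow> mpseries" where
  "elem_sym_part p = prod_mset (image_mset elem_sym p)"

definition e_expansion :: "mpseries \<Rightarrow> (nat multiset \<Rightarrow>\<^sub>0 rat) \<Rightarrow> bool" where
  "e_expansion f c \<longleftrightarrow>
     (\<forall>p\<in>Poly_Mapping.keys c. is_partition p) \<and>
     f = (\<Sum>p\<in>Poly_Mapping.keys c. mconst (Poly_Mapping.lookup c p) * elem_sym_part p)"

type_synonym 'a sgraph = "'a set \<times> 'a set set"

abbreviation verts :: "'a sgraph \<Rightarrow> 'a set" where "verts G \<equiv> fst G"
abbreviation edges :: "'a sgraph \<Rightarrow> 'a set set" where "edges G \<equiv> snd G"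

definition simple_graph :: "'a sgraph \<Rightarrow> bool" where
  "simple_graph G \<longleftrightarrow> finite (verts G) \<and> verts G \<noteq> {} \<and>
     (\<forall>e\<in>edges G. \<exists>u v. e = {u, v} \<and> u \<noteq> v \<and> u \<in> verts G \<and> v \<in> verts G)"

definition gsize :: "'a sgraph \<Rightarrow> nat" where
  "gsize G = card (verts G)"

definition add_edges :: "'a sgraph \<Rightarrow> 'a set set \<Rightarrow> 'a sgraph" where
  "add_edges G S = (verts G, edges G \<union> S)"

text \<open>
  Colourings are extensional functions, so that two of them are equal iff they agree on the
  vertices.
\<close>

definition proper_colourings :: "'a sgraph \<Rightarrow> ('a \<Rightarrow> nat) set" where
  "proper_colourings G =
     {\<kappa> \<in> verts G \<rightarrow>\<^sub>E {1..}. \<forall>u v. {u, v} \<in> edges G \<longrightarrow> \<kappa> u \<noteq> \<kappa> v}"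

definition chromatic_sym :: "'a sgraph \<Rightarrow> mpseries" where
  "chromatic_sym G = monomial_sum (proper_colourings G) (\<lambda>\<kappa>. var_prod (verts G) \<kappa>)"

text \<open>
  The \<open>e\<^sub>p\<close> are a basis of the symmetric functions, so there is at most one expansion \<open>c\<close>.
\<close>

definition e_positive :: "'a sgraph \<Rightarrow> bool" where
  "e_positive G \<longleftrightarrow> (\<exists>c. e_expansion (chromatic_sym G) c \<and> (\<forall>p. 0 \<le> Poly_Mapping.lookup c p))"

lemma keys_var_prod: "finite I \<Longrightarrow> Poly_Mapping.keys (var_prod I f) = f ` I"
proof (induction I rule: finite_induct)
  case empty
  then show ?case by (simp add: var_prod_def)
next
  case (insert i I)
  then have "var_prod (insert i I) f = Poly_Mapping.single (f i) 1 + var_prod I f"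
    by (simp add: var_prod_def)
  moreover have "Poly_Mapping.keys (Poly_Mapping.single (f i) 1 + var_prod I f) =
                 insert (f i) (Poly_Mapping.keys (var_prod I f))"
    by (auto simp: in_keys_iff lookup_add lookup_single when_def split: if_splits)
  ultimately show ?case using insert by simp
qed

lemma finite_fibres_chromatic_sym:
  assumes "finite (verts G)"
  shows "finite {\<kappa> \<in> proper_colourings G. var_prod (verts G) \<kappa> = m}"
proof (rule finite_subset)
  show "{\<kappa> \<in> proper_colourings G. var_prod (verts G) \<kappa> = m} \<subseteq> verts G \<rightarrow>\<^sub>E Poly_Mapping.keys m"
  proof
    fix \<kappa> assume "\<kappa> \<in> {\<kappa> \<in> proper_colourings G. var_prod (verts G) \<kappa> = m}"
    then have "\<kappa> \<in> extensional (verts G)" and m: "m = var_prod (verts G) \<kappa>"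
      by (simp_all add: proper_colourings_def PiE_iff)
    moreover have "\<kappa> ` verts G = Poly_Mapping.keys m"
      unfolding m using keys_var_prod[OF assms, of \<kappa>] by (rule sym)
    ultimately show "\<kappa> \<in> verts G \<rightarrow>\<^sub>E Poly_Mapping.keys m"
      by (simp only: PiE_iff) blast
  qed
  show "finite (verts G \<rightarrow>\<^sub>E Poly_Mapping.keys m)"
    using assms by (simp add: finite_PiE)
qed

lemma finite_fibres_elem_sym: "finite {J \<in> elem_index_sets i. var_prod J id = m}"
proof (rule finite_subset)
  show "{J \<in> elem_index_sets i. var_prod J id = m} \<subseteq> {Poly_Mapping.keys m}"
    by (auto simp: elem_index_sets_def keys_var_prod)
qed simp

definition labelled_graph :: "nat sgraph \<Rightarrow> bool" where
  "labelled_graph G \<longleftrightarrow> simple_graph G \<and> verts G = {1..gsize G}"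

definition labelled_unit_interval_graph :: "nat sgraph \<Rightarrow> bool" where
  "labelled_unit_interval_graph G \<longleftrightarrow> labelled_graph G \<and>
     (\<forall>i j v w. i \<le> v \<and> v < w \<and> w \<le> j \<and> {i, j} \<in> edges G \<longrightarrow> {v, w} \<in> edges G)"

definition closed_nbhd :: "'a sgraph \<Rightarrow> 'a \<Rightarrow> 'a set" where
  "closed_nbhd G i = insert i {u. {i, u} \<in> edges G}"

definition max_nbr :: "nat sgraph \<Rightarrow> nat \<Rightarrow> nat" where
  "max_nbr G i = Max (closed_nbhd G i)"

definition min_nbr :: "nat sgraph \<Rightarrow> nat \<Rightarrow> nat" where
  "min_nbr G i = Min (closed_nbhd G i)"

text \<open>The progression has the \<open>k + 1\<close> terms \<open>a 0, \<dots>, a k\<close>.\<close>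

definition arith_progression :: "nat \<Rightarrow> (nat \<Rightarrow> 'a :: ab_group_add) \<Rightarrow> bool" where
  "arith_progression k a \<longleftrightarrow> (\<exists>d. \<forall>j<k. a (Suc j) - a j = d)"

end

theory Submission
  imports Defs "HOL-Combinatorics.Transposition"
begin

text \<open>
  Passing from \<open>G\<^sub>j\<close> to \<open>G\<^sub>j\<^sub>+\<^sub>1\<close> adds one edge \<open>ib\<close> and so removes from the chromatic symmetric function the proper
  colourings of \<open>G\<^sub>j\<close> that agree on \<open>i\<close> and \<open>b\<close>.  In a labelled unit interval graph closed neighbourhoods are intervals,
  so the new endpoints \<open>b\<close> have the same closed neighbourhood in \<open>G\<close>: they form a clique of twins.  Since they form a
  clique, the colourings removed are already the proper colourings of \<open>G\<close> that agree on \<open>i\<close> and \<open>b\<close>; since they are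
  twins, their generating function does not depend on \<open>b\<close>.  Every term of an arithmetic progression is a
  convex combination of the first and the last one, and \<open>e\<close>-positivity is preserved by convex combinations.
\<close>

section \<open>Formal sums of monomials and the effect of a new edge\<close>

lemma monomial_sum_reindex:
  assumes "bij_betw f A B" and "\<And>a. a \<in> A \<Longrightarrow> mon' (f a) = mon a"
  shows "monomial_sum A mon = monomial_sum B mon'"
proof (rule mpseries_eqI)
  fix m
  have "bij_betw f {a \<in> A. mon a = m} {b \<in> B. mon' b = m}"
    using assms unfolding bij_betw_def inj_on_def by (auto simp: image_iff)
  then show "mcoeff (monomial_sum A mon) m = mcoeff (monomial_sum B mon') m"
    by (simp add: mcoeff_monomial_sum bij_betw_same_card)
qed

text \<open>Coefficients count fibres with \<open>card\<close>, which is 0 on infinite sets; finite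
  fibres make the counts add.\<close>

lemma monomial_sum_Un_disjoint:
  assumes "A \<inter> B = {}" and "\<And>m. finite {a \<in> A \<union> B. mon a = m}"
  shows "monomial_sum (A \<union> B) mon = monomial_sum A mon + monomial_sum B mon"
proof (rule mpseries_eqI)
  fix m
  have eq: "{a \<in> A \<union> B. mon a = m} = {a \<in> A. mon a = m} \<union> {a \<in> B. mon a = m}"
    by auto
  have "card {a \<in> A \<union> B. mon a = m} = card {a \<in> A. mon a = m} + card {a \<in> B. mon a = m}"
    unfolding eq using assms(1) assms(2)[of m] unfolding eq by (intro card_Un_disjoint) auto
  then show "mcoeff (monomial_sum (A \<union> B) mon) m = mcoeff (monomial_sum A mon + monomial_sum B mon) m"
    by (simp add: mcoeff_monomial_sum plus_mpseries.rep_eq)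
qed

lemma var_prod_comp_bij:
  assumes "bij_betw \<tau> I I"
  shows "var_prod I (\<kappa> \<circ> \<tau>) = var_prod I \<kappa>"
  unfolding var_prod_def o_def
  using sum.reindex_bij_betw[OF assms, of "\<lambda>i. Poly_Mapping.single (\<kappa> i) 1"] .

text \<open>A proper colouring of \<open>G\<close> either separates \<open>u\<close> and
  \<open>v\<close>, and then is proper after adding the edge, or agrees on them.\<close>

lemma chromatic_sym_add_edge:
  assumes "finite (verts G)"
  shows "chromatic_sym G = chromatic_sym (add_edges G {{u, v}}) +
           monomial_sum {\<kappa> \<in> proper_colourings G. \<kappa> u = \<kappa> v} (var_prod (verts G))"
proof -
  let ?A = "proper_colourings (add_edges G {{u, v}})"
  let ?B = "{\<kappa> \<in> proper_colourings G. \<kappa> u = \<kappa> v}"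
  have disj: "?A \<inter> ?B = {}"
    by (auto simp: proper_colourings_def add_edges_def)
  have un: "?A \<union> ?B = proper_colourings G"
    by (auto simp: proper_colourings_def add_edges_def doubleton_eq_iff)
  show ?thesis
    using monomial_sum_Un_disjoint[OF disj, of "var_prod (verts G)"] finite_fibres_chromatic_sym[OF assms]
    unfolding un chromatic_sym_def by (simp add: add_edges_def)
qed

section \<open>Twin vertices and the resulting arithmetic progression\<close>

lemma twins_adjacent:
  assumes "closed_nbhd G u = closed_nbhd G v" and "u \<noteq> v"
  shows "{u, v} \<in> edges G"
proof -
  have "v \<in> closed_nbhd G v"
    by (simp add: closed_nbhd_def)
  then have "v \<in> closed_nbhd G u"
    by (simp only: assms(1))
  then show ?thesis
    using assms(2) by (simp add: closed_nbhd_def)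
qed

text \<open>Swapping two twins is an automorphism: it preserves the edge between them, and every
  other vertex is adjacent to both or to neither.\<close>

lemma transpose_twins_edge:
  assumes "simple_graph G" and tw: "closed_nbhd G u = closed_nbhd G v" and e: "{x, y} \<in> edges G"
  shows "{transpose u v x, transpose u v y} \<in> edges G"
proof (cases "u = v")
  case False
  then have uv: "{u, v} \<in> edges G" "{v, u} \<in> edges G"
    using twins_adjacent[OF tw] by (simp_all add: insert_commute)
  have "x \<noteq> y"
    using assms(1) e by (fastforce simp: simple_graph_def doubleton_eq_iff)
  have swap: "{u, z} \<in> edges G \<longleftrightarrow> {v, z} \<in> edges G" if "z \<noteq> u" "z \<noteq> v" for z
    using tw that by (auto simp: closed_nbhd_def set_eq_iff)
  then have swap': "{z, u} \<in> edges G \<longleftrightarrow> {z, v} \<in> edges G" if "z \<noteq> u" "z \<noteq> v" for z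
    using that by (simp add: insert_commute[of z])
  consider "x \<in> {u, v}" "y \<in> {u, v}" | "x \<in> {u, v}" "y \<notin> {u, v}"
    | "x \<notin> {u, v}" "y \<in> {u, v}" | "x \<notin> {u, v}" "y \<notin> {u, v}"
    by blast
  then show ?thesis
  proof cases
    case 1
    then show ?thesis
      using \<open>x \<noteq> y\<close> uv by (elim insertE emptyE) simp_all
  next
    case 2
    then show ?thesis
      using e swap[of y] by (elim insertE emptyE) simp_all
  next
    case 3
    then show ?thesis
      using e swap'[of x] by (elim insertE emptyE) simp_all
  next
    case 4
    then show ?thesis
      using e by simp
  qed
qed (use e in simp)

lemma proper_colouring_transpose_twins:
  assumes "simple_graph G" and "closed_nbhd G u = closed_nbhd G v"
    and "u \<in> verts G" and "v \<in> verts G" and "\<kappa> \<in> proper_colourings G"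
  shows "\<kappa> \<circ> transpose u v \<in> proper_colourings G"
proof -
  \<comment> \<open>The equivalence serves twice: colours of vertices stay positive, and outside
    \<open>verts G\<close> the composite stays \<open>undefined\<close>, hence extensional.\<close>
  have "transpose u v x \<in> verts G \<longleftrightarrow> x \<in> verts G" for x
    using assms(3,4) by (simp add: transpose_def)
  moreover have "{transpose u v x, transpose u v y} \<in> edges G" if "{x, y} \<in> edges G" for x y
    using transpose_twins_edge[OF assms(1,2) that] .
  ultimately show ?thesis
    using assms(5) by (simp add: proper_colourings_def PiE_iff extensional_def)
qed

text \<open>Composing with the transposition is an involution that keeps the monomial. As it fixes
  \<open>i\<close>, it exchanges agreement of \<open>i\<close> with \<open>u\<close> for agreement
  of \<open>i\<close> with \<open>v\<close>.\<close>

lemma monomial_sum_agreeing_twins: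
  assumes "simple_graph G" and "closed_nbhd G u = closed_nbhd G v"
    and "u \<in> verts G" and "v \<in> verts G" and "i \<noteq> u" and "i \<noteq> v"
  shows "monomial_sum {\<kappa> \<in> proper_colourings G. \<kappa> i = \<kappa> u} (var_prod (verts G)) =
         monomial_sum {\<kappa> \<in> proper_colourings G. \<kappa> i = \<kappa> v} (var_prod (verts G))"
proof (rule monomial_sum_reindex)
  let ?f = "\<lambda>\<kappa>. \<kappa> \<circ> transpose u v"
  have invol: "?f (?f \<kappa>) = \<kappa>" for \<kappa> :: "_ \<Rightarrow> nat"
    by (simp add: fun_eq_iff)
  show "bij_betw ?f {\<kappa> \<in> proper_colourings G. \<kappa> i = \<kappa> u} {\<kappa> \<in> proper_colourings G. \<kappa> i = \<kappa> v}"
  proof (rule bij_betw_byWitness[where f' = ?f])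
    show "?f ` {\<kappa> \<in> proper_colourings G. \<kappa> i = \<kappa> u} \<subseteq> {\<kappa> \<in> proper_colourings G. \<kappa> i = \<kappa> v}"
      and "?f ` {\<kappa> \<in> proper_colourings G. \<kappa> i = \<kappa> v} \<subseteq> {\<kappa> \<in> proper_colourings G. \<kappa> i = \<kappa> u}"
      using assms(5,6) proper_colouring_transpose_twins[OF assms(1-4)] by (simp_all add: image_subset_iff)
  qed (simp_all only: invol, simp_all)
  have "bij_betw (transpose u v) (verts G) (verts G)"
    by (rule bij_betw_byWitness[where f' = "transpose u v"])
       (use assms(3,4) in \<open>auto simp: transpose_def\<close>)
  then show "var_prod (verts G) (?f \<kappa>) = var_prod (verts G) \<kappa>" for \<kappa>
    by (rule var_prod_comp_bij)
qed

text \<open>If \<open>\<kappa> i = \<kappa> b\<close> and \<open>c\<close> is adjacent to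
  \<open>b\<close>, then \<open>\<kappa> c\<close> already differs from \<open>\<kappa> i\<close>,
  so the edge from \<open>i\<close> to \<open>c\<close> imposes no new condition.\<close>

lemma proper_colourings_agreeing_add_edges:
  assumes "\<And>c. c \<in> C \<Longrightarrow> {c, b} \<in> edges G"
  shows "{\<kappa> \<in> proper_colourings (add_edges G ((\<lambda>c. {i, c}) ` C)). \<kappa> i = \<kappa> b} =
         {\<kappa> \<in> proper_colourings G. \<kappa> i = \<kappa> b}"
    (is "?L = ?R")
proof (intro equalityI subsetI)
  fix \<kappa> assume "\<kappa> \<in> ?L"
  then show "\<kappa> \<in> ?R"
    by (simp add: proper_colourings_def add_edges_def)
next
  fix \<kappa> assume "\<kappa> \<in> ?R"
  then have \<kappa>: "\<kappa> \<in> verts G \<rightarrow>\<^sub>E {1..}" "\<kappa> i = \<kappa> b"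
    and edge: "\<And>x y. {x, y} \<in> edges G \<Longrightarrow> \<kappa> x \<noteq> \<kappa> y"
    by (auto simp: proper_colourings_def)
  have "\<kappa> x \<noteq> \<kappa> y" if "{x, y} \<in> (\<lambda>c. {i, c}) ` C" for x y
  proof -
    from that obtain c where "c \<in> C" and xy: "{x, y} = {i, c}" by blast
    then have "\<kappa> i \<noteq> \<kappa> c"
      using edge[OF assms] \<kappa>(2) by metis
    with xy show ?thesis
      by (auto simp: doubleton_eq_iff)
  qed
  then show "\<kappa> \<in> ?L"
    using \<kappa> edge by (auto simp: proper_colourings_def add_edges_def)
qed

lemma arith_progression_add_edges_twins:
  assumes G: "simple_graph G" and inj: "inj_on b {1..k}"
    and b: "\<And>l. l \<in> {1..k} \<Longrightarrow> b l \<in> verts G \<and> b l \<noteq> i"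
    and tw: "\<And>l. l \<in> {1..k} \<Longrightarrow> closed_nbhd G (b l) = closed_nbhd G (b 1)"
  shows "arith_progression k (\<lambda>j. chromatic_sym (add_edges G ((\<lambda>l. {i, b l}) ` {1..j})))"
  unfolding arith_progression_def
proof (intro exI allI impI)
  fix j assume "j < k"
  let ?H = "add_edges G ((\<lambda>l. {i, b l}) ` {1..j})"
  let ?d = "\<lambda>c. monomial_sum {\<kappa> \<in> proper_colourings G. \<kappa> i = \<kappa> c} (var_prod (verts G))"
  \<comment> \<open>Injectivity of \<open>b\<close> makes the earlier endpoints distinct from the
    new one, and distinct twins are adjacent.\<close>
  have adj: "{c, b (Suc j)} \<in> edges G" if "c \<in> b ` {1..j}" for c
  proof -
    from that obtain l where l: "c = b l" "l \<in> {1..j}" by blast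
    then have "b l \<noteq> b (Suc j)"
      using \<open>j < k\<close> inj_onD[OF inj, of l "Suc j"] by auto
    then show ?thesis
      using l \<open>j < k\<close> twins_adjacent[of G "b l" "b (Suc j)"] tw[of l] tw[of "Suc j"] by simp
  qed
  have H: "?H = add_edges G ((\<lambda>c. {i, c}) ` (b ` {1..j}))"
    by (simp add: image_image)
  have step: "add_edges ?H {{i, b (Suc j)}} = add_edges G ((\<lambda>l. {i, b l}) ` {1..Suc j})"
    by (simp add: add_edges_def atLeastAtMostSuc_conv)
  have "chromatic_sym ?H = chromatic_sym (add_edges ?H {{i, b (Suc j)}}) +
      monomial_sum {\<kappa> \<in> proper_colourings ?H. \<kappa> i = \<kappa> (b (Suc j))} (var_prod (verts ?H))"
    by (rule chromatic_sym_add_edge) (use G in \<open>simp add: add_edges_def simple_graph_def\<close>)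
  also have "monomial_sum {\<kappa> \<in> proper_colourings ?H. \<kappa> i = \<kappa> (b (Suc j))} (var_prod (verts ?H)) = ?d (b (Suc j))"
    unfolding H using proper_colourings_agreeing_add_edges[of "b ` {1..j}" "b (Suc j)" G i] adj
    by (simp add: add_edges_def)
  also have "?d (b (Suc j)) = ?d (b 1)"
    using \<open>j < k\<close> b[of "Suc j"] b[of 1] tw[of "Suc j"] by (intro monomial_sum_agreeing_twins[OF G]) auto
  \<comment> \<open>The common difference carries a minus sign because each new edge removes
    colourings.\<close>
  finally show "chromatic_sym (add_edges G ((\<lambda>l. {i, b l}) ` {1..Suc j})) - chromatic_sym ?H = - ?d (b 1)"
    unfolding step by (simp add: algebra_simps)
qed

section \<open>Linear combinations of e-expansions\<close>

lemma mconst_0 [simp]: "mconst 0 = 0"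
  by (rule mpseries_eqI) (simp add: mconst.rep_eq zero_mpseries.rep_eq)

lemma mconst_1 [simp]: "mconst 1 = 1"
  by (rule mpseries_eqI) (simp add: mconst.rep_eq one_mpseries.rep_eq)

lemma mconst_add: "mconst (a + b) = mconst a + mconst b"
  by (rule mpseries_eqI) (simp add: mconst.rep_eq plus_mpseries.rep_eq)

text \<open>Only the split \<open>(0, m)\<close> contributes to the convolution, since a constant is
  supported at the exponent 0.\<close>

lemma mcoeff_mconst_mult: "mcoeff (mconst a * f) m = a * mcoeff f m"
proof -
  have "mcoeff (mconst a * f) m = (\<Sum>(x, y)\<in>splits m. (if x = 0 then a else 0) * mcoeff f y)"
    by (simp add: times_mpseries.rep_eq mconst.rep_eq)
  also have "\<dots> = (\<Sum>(x, y)\<in>{(0 :: monom, m)}. (if x = 0 then a else 0) * mcoeff f y)"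
    by (rule sum.mono_neutral_right) (auto simp: finite_splits, auto simp: splits_def split: if_splits)
  finally show ?thesis by simp
qed

lemma mconst_mult: "mconst (a * b) = mconst a * mconst b"
  by (rule mpseries_eqI) (simp add: mcoeff_mconst_mult mconst.rep_eq)

lemma mconst_of_nat: "mconst (of_nat n) = of_nat n"
  by (induction n) (simp_all add: mconst_add)

text \<open>The sum in \<open>e_expansion\<close>, separated from the condition on the keys so that
  its linearity can be treated alone.\<close>

definition e_combination :: "(nat multiset \<Rightarrow>\<^sub>0 rat) \<Rightarrow> mpseries" where
  "e_combination c = (\<Sum>p\<in>Poly_Mapping.keys c. mconst (Poly_Mapping.lookup c p) * elem_sym_part p)"

text \<open>Keys can cancel in a sum, so linearity is proved over a common finite index set, where
  the extra terms vanish.\<close>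

lemma e_combination_superset:
  assumes "finite S" and "Poly_Mapping.keys c \<subseteq> S"
  shows "e_combination c = (\<Sum>p\<in>S. mconst (Poly_Mapping.lookup c p) * elem_sym_part p)"
  unfolding e_combination_def
  by (rule sum.mono_neutral_left) (use assms in \<open>auto simp: in_keys_iff\<close>)

lemma e_combination_add: "e_combination (c + d) = e_combination c + e_combination d"
proof -
  let ?S = "Poly_Mapping.keys c \<union> Poly_Mapping.keys d"
  have "e_combination x = (\<Sum>p\<in>?S. mconst (Poly_Mapping.lookup x p) * elem_sym_part p)"
    if "x \<in> {c, d, c + d}" for x
    using that Poly_Mapping.keys_add[of c d] by (intro e_combination_superset) auto
  then show ?thesis
    by (simp add: lookup_add mconst_add distrib_right sum.distrib)
qed

lemma lookup_map_mult: "Poly_Mapping.lookup (Poly_Mapping.map ((*) a) c) p = a * Poly_Mapping.lookup c p"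
  for a :: rat
  by (simp add: map.rep_eq when_def)

text \<open>Equality fails for \<open>a = 0\<close> when \<open>c\<close> has keys; this scalar does
  occur, as a weight at either end of the progression.\<close>

lemma keys_map_mult_subset: "Poly_Mapping.keys (Poly_Mapping.map ((*) a) c) \<subseteq> Poly_Mapping.keys c"
  for a :: rat
  by (auto simp: in_keys_iff lookup_map_mult)

lemma e_combination_map_mult: "e_combination (Poly_Mapping.map ((*) a) c) = mconst a * e_combination c"
  unfolding e_combination_superset[OF finite_keys keys_map_mult_subset]
  by (simp add: e_combination_def lookup_map_mult mconst_mult sum_distrib_left mult.assoc)

lemma e_expansion_linear_combination:
  assumes "e_expansion f c" and "e_expansion g d"
  shows "e_expansion (mconst a * f + mconst b * g) (Poly_Mapping.map ((*) a) c + Poly_Mapping.map ((*) b) d)"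
    (is "e_expansion _ ?c")
proof -
  have "Poly_Mapping.keys ?c \<subseteq> Poly_Mapping.keys c \<union> Poly_Mapping.keys d"
    using Poly_Mapping.keys_add keys_map_mult_subset by fast
  moreover have "f = e_combination c" "g = e_combination d"
    using assms by (simp_all add: e_expansion_def e_combination_def)
  then have "mconst a * f + mconst b * g = e_combination ?c"
    by (simp only: e_combination_add e_combination_map_mult)
  ultimately show ?thesis
    using assms by (auto simp: e_expansion_def e_combination_def)
qed

section \<open>Convex combinations along an arithmetic progression\<close>

lemma arith_progression_nth:
  fixes a :: "nat \<Rightarrow> 'a :: comm_ring_1"
  assumes "\<And>j. j < k \<Longrightarrow> a (Suc j) - a j = d" and "j \<le> k"
  shows "a j = a 0 + of_nat j * d"
  using assms(2)
proof (induction j)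
  case (Suc j)
  then show ?case
    using assms(1)[of j] by (simp add: algebra_simps)
qed simp

lemma arith_progression_convex:
  fixes a :: "nat \<Rightarrow> mpseries"
  assumes "arith_progression k a" and "j \<le> k" and "k \<ge> 1"
  shows "a j = mconst (1 - of_nat j / of_nat k) * a 0 + mconst (of_nat j / of_nat k) * a k"
proof -
  obtain d where d: "\<And>j. j < k \<Longrightarrow> a (Suc j) - a j = d"
    using assms(1) by (auto simp: arith_progression_def)
  let ?t = "of_nat j / of_nat k :: rat"
  have nth: "a j = a 0 + of_nat j * d" "a k = a 0 + of_nat k * d"
    using assms(2) by (auto intro: arith_progression_nth d)
  \<comment> \<open>After substituting \<open>a k\<close>, the weights on \<open>a 0\<close> add up
    to 1 and \<open>d\<close> receives \<open>?t\<close> times \<open>k\<close>, which is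
    \<open>j\<close> because \<open>k\<close> is nonzero.\<close>
  have "mconst (1 - ?t) * a 0 + mconst ?t * a k =
      (mconst (1 - ?t) + mconst ?t) * a 0 + mconst ?t * mconst (of_nat k) * d"
    by (simp only: nth mconst_of_nat) (simp add: algebra_simps)
  also have "\<dots> = mconst 1 * a 0 + mconst (of_nat j) * d"
    using assms(3) by (simp flip: mconst_add mconst_mult)
  finally show ?thesis
    by (simp add: nth(1) mconst_of_nat)
qed

lemma e_positive_arith_progression:
  assumes "arith_progression k (\<lambda>j. chromatic_sym (H j))" and "k \<ge> 1"
    and "e_positive (H 0)" and "e_positive (H k)" and "j \<le> k"
  shows "e_positive (H j)"
proof -
  obtain c d where cd: "e_expansion (chromatic_sym (H 0)) c" "e_expansion (chromatic_sym (H k)) d"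
    and nonneg: "\<And>p. 0 \<le> Poly_Mapping.lookup c p" "\<And>p. 0 \<le> Poly_Mapping.lookup d p"
    using assms(3,4) by (auto simp: e_positive_def)
  let ?t = "of_nat j / of_nat k :: rat"
  have t: "0 \<le> ?t" "?t \<le> 1"
    using assms(2,5) by auto
  show ?thesis
    unfolding e_positive_def arith_progression_convex[OF assms(1,5,2)]
    using e_expansion_linear_combination[OF cd, of "1 - ?t" ?t] t nonneg
    by (intro exI conjI) (auto simp: lookup_add lookup_map_mult)
qed

section \<open>Closed neighbourhoods in unit interval graphs\<close>

lemma finite_closed_nbhd:
  assumes "simple_graph G"
  shows "finite (closed_nbhd G v)"
proof (rule finite_subset)
  \<comment> \<open>Since \<open>v\<close> is not assumed to be a vertex, it is inserted
    separately.\<close>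
  show "closed_nbhd G v \<subseteq> insert v (verts G)"
    using assms by (fastforce simp: closed_nbhd_def simple_graph_def doubleton_eq_iff)
  show "finite (insert v (verts G))"
    using assms by (simp add: simple_graph_def)
qed

lemma min_nbr_le_self: "simple_graph G \<Longrightarrow> min_nbr G v \<le> v"
  unfolding min_nbr_def by (rule Min_le) (simp_all add: finite_closed_nbhd, simp add: closed_nbhd_def)

lemma self_le_max_nbr: "simple_graph G \<Longrightarrow> v \<le> max_nbr G v"
  unfolding max_nbr_def by (rule Max_ge) (simp_all add: finite_closed_nbhd, simp add: closed_nbhd_def)

text \<open>Each extreme is \<open>v\<close> itself or a neighbour of \<open>v\<close>; in the
  latter case the unit interval property joins \<open>v\<close> to everything in between. Hence
  equal pairs of extremes mean equal closed neighbourhoods.\<close>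

lemma closed_nbhd_eq_interval:
  assumes "labelled_unit_interval_graph G"
  shows "closed_nbhd G v = {min_nbr G v..max_nbr G v}"
proof -
  have simple: "simple_graph G"
    and conv: "\<And>i j x y. i \<le> x \<Longrightarrow> x < y \<Longrightarrow> y \<le> j \<Longrightarrow> {i, j} \<in> edges G \<Longrightarrow> {x, y} \<in> edges G"
    using assms by (auto simp: labelled_unit_interval_graph_def labelled_graph_def)
  have fin: "finite (closed_nbhd G v)" and ne: "closed_nbhd G v \<noteq> {}"
    using finite_closed_nbhd[OF simple] by (auto simp: closed_nbhd_def)
  have mem: "min_nbr G v \<in> closed_nbhd G v" "max_nbr G v \<in> closed_nbhd G v"
    using Min_in[OF fin ne] Max_in[OF fin ne] by (simp_all only: min_nbr_def max_nbr_def)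
  show ?thesis
  proof (intro equalityI subsetI)
    fix x assume "x \<in> closed_nbhd G v"
    then show "x \<in> {min_nbr G v..max_nbr G v}"
      using fin by (simp add: min_nbr_def max_nbr_def)
  next
    fix x assume x: "x \<in> {min_nbr G v..max_nbr G v}"
    consider "x < v" | "x = v" | "v < x" by linarith
    then show "x \<in> closed_nbhd G v"
    proof cases
      case 1
      then have "{min_nbr G v, v} \<in> edges G"
        using x mem(1) by (auto simp: closed_nbhd_def insert_commute)
      then show ?thesis
        using conv[of "min_nbr G v" x v v] 1 x by (simp add: closed_nbhd_def insert_commute)
    next
      case 2
      then show ?thesis by (simp add: closed_nbhd_def)
    next
      case 3
      then have "{v, max_nbr G v} \<in> edges G"
        using x mem(2) by (auto simp: closed_nbhd_def)
      then show ?thesis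
        using conv[of v v x "max_nbr G v"] 3 x by (simp add: closed_nbhd_def)
    qed
  qed
qed

text \<open>Common form of both halves of the theorem: \<open>b\<close> enumerates the new endpoints
  in the order of insertion, upwards from \<open>m i\<close> or downwards from
  \<open>w i\<close>.\<close>

lemma add_edges_to_twins:
  assumes G: "labelled_unit_interval_graph G" and k: "k \<ge> 1"
    and inj: "inj_on b {1..k}" and b: "\<And>l. l \<in> {1..k} \<Longrightarrow> b l \<in> verts G \<and> b l \<noteq> i"
    and tw: "\<And>l. l \<in> {1..k} \<Longrightarrow>
      (min_nbr G (b l), max_nbr G (b l)) = (min_nbr G (b 1), max_nbr G (b 1))"
    and Gs: "\<And>j. j \<le> k \<Longrightarrow> Gs j = add_edges G ((\<lambda>l. {i, b l}) ` {1..j})"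
  shows "arith_progression k (\<lambda>j. chromatic_sym (Gs j)) \<and>
      (e_positive (Gs 0) \<and> e_positive (Gs k) \<longrightarrow> (\<forall>j\<le>k. e_positive (Gs j)))"
proof -
  have simple: "simple_graph G"
    using G by (simp add: labelled_unit_interval_graph_def labelled_graph_def)
  have nbhd: "closed_nbhd G (b l) = closed_nbhd G (b 1)" if "l \<in> {1..k}" for l
    using tw[OF that] by (simp add: closed_nbhd_eq_interval[OF G])
  have "arith_progression k (\<lambda>j. chromatic_sym (add_edges G ((\<lambda>l. {i, b l}) ` {1..j})))"
    by (rule arith_progression_add_edges_twins[OF simple inj b nbhd])
  then have "arith_progression k (\<lambda>j. chromatic_sym (Gs j))"
    by (simp add: arith_progression_def Gs)
  then show ?thesis
    using e_positive_arith_progression[OF _ k, of Gs] by blast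
qed

theorem corollary3p3:
  fixes G :: "nat sgraph" and m w :: "nat \<Rightarrow> nat" and k :: nat
  assumes G: "labelled_unit_interval_graph G"
    and m_def: "m = max_nbr G"
    and w_def: "w = min_nbr G"
    and k: "k \<ge> 1"
  shows
    "(\<forall>i Gs.
        i \<in> verts G \<and> i < gsize G \<and> m i + 1 \<le> m (i + 1) \<and> m i + k \<le> gsize G \<and>
        (\<forall>l\<in>{1..k}. (w (m i + l), m (m i + l)) = (w (m i + 1), m (m i + 1))) \<and>
        Gs = (\<lambda>j. add_edges G {{i, b} | b. m i + 1 \<le> b \<and> b \<le> m i + j}) \<longrightarrow>
          arith_progression k (\<lambda>j. chromatic_sym (Gs j)) \<and>
          (e_positive (Gs 0) \<and> e_positive (Gs k) \<longrightarrow> (\<forall>j\<le>k. e_positive (Gs j)))) \<and>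
     (\<forall>i Gs.
        i \<in> verts G \<and> i > 1 \<and> w i - 1 \<ge> w (i - 1) \<and> w i - k \<ge> 1 \<and>
        (\<forall>l\<in>{1..k}. (w (w i - l), m (w i - l)) = (w (w i - 1), m (w i - 1))) \<and>
        Gs = (\<lambda>j. add_edges G {{b, i} | b. w i - 1 \<ge> b \<and> b \<ge> w i - j}) \<longrightarrow>
          arith_progression k (\<lambda>j. chromatic_sym (Gs j)) \<and>
          (e_positive (Gs 0) \<and> e_positive (Gs k) \<longrightarrow> (\<forall>j\<le>k. e_positive (Gs j))))"
proof (rule conjI; intro allI impI; elim conjE)
  have simple: "simple_graph G" and verts: "verts G = {1..gsize G}"
    using G by (auto simp: labelled_unit_interval_graph_def labelled_graph_def)
  fix i and Gs :: "nat \<Rightarrow> nat sgraph"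
  assume i: "i \<in> verts G"
  \<comment> \<open>These bounds keep the new endpoints \<open>m i + l\<close> and
    \<open>w i - l\<close> away from \<open>i\<close>.\<close>
  have w_le: "w i \<le> i" and m_ge: "i \<le> m i"
    by (simp_all add: w_def m_def min_nbr_le_self[OF simple] self_le_max_nbr[OF simple])
  {
    assume le: "m i + k \<le> gsize G"
      and tw: "\<forall>l\<in>{1..k}. (w (m i + l), m (m i + l)) = (w (m i + 1), m (m i + 1))"
      and Gs: "Gs = (\<lambda>j. add_edges G {{i, b} | b. m i + 1 \<le> b \<and> b \<le> m i + j})"
    show "arith_progression k (\<lambda>j. chromatic_sym (Gs j)) \<and>
        (e_positive (Gs 0) \<and> e_positive (Gs k) \<longrightarrow> (\<forall>j\<le>k. e_positive (Gs j)))"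
    proof (rule add_edges_to_twins[OF G k])
      show "inj_on (\<lambda>l. m i + l) {1..k}"
        by simp
      show "m i + l \<in> verts G \<and> m i + l \<noteq> i" if "l \<in> {1..k}" for l
        using that le m_ge verts by auto
      show "(min_nbr G (m i + l), max_nbr G (m i + l)) = (min_nbr G (m i + 1), max_nbr G (m i + 1))"
        if "l \<in> {1..k}" for l
        using tw that by (simp only: m_def w_def)
      show "Gs j = add_edges G ((\<lambda>l. {i, m i + l}) ` {1..j})" for j
      proof -
        have "{b. m i + 1 \<le> b \<and> b \<le> m i + j} = (\<lambda>l. m i + l) ` {1..j}"
          by auto
        then show ?thesis
          by (simp only: Gs setcompr_eq_image image_image)
      qed
    qed
  next
    assume ge: "w i - k \<ge> 1"
      and tw: "\<forall>l\<in>{1..k}. (w (w i - l), m (w i - l)) = (w (w i - 1), m (w i - 1))"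
      and Gs: "Gs = (\<lambda>j. add_edges G {{b, i} | b. w i - 1 \<ge> b \<and> b \<ge> w i - j})"
    show "arith_progression k (\<lambda>j. chromatic_sym (Gs j)) \<and>
        (e_positive (Gs 0) \<and> e_positive (Gs k) \<longrightarrow> (\<forall>j\<le>k. e_positive (Gs j)))"
    proof (rule add_edges_to_twins[OF G k])
      \<comment> \<open>On naturals, \<open>ge\<close> forces \<open>k < w i\<close>, so no
        subtraction is truncated for \<open>l\<close> up to \<open>k\<close>.\<close>
      show "inj_on (\<lambda>l. w i - l) {1..k}"
        using ge by (auto simp: inj_on_def)
      show "w i - l \<in> verts G \<and> w i - l \<noteq> i" if "l \<in> {1..k}" for l
        using that ge w_le i verts by auto
      show "(min_nbr G (w i - l), max_nbr G (w i - l)) = (min_nbr G (w i - 1), max_nbr G (w i - 1))"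
        if "l \<in> {1..k}" for l
        using tw that by (simp only: m_def w_def)
      show "Gs j = add_edges G ((\<lambda>l. {i, w i - l}) ` {1..j})" if "j \<le> k" for j
      proof -
        \<comment> \<open>The index of the endpoint \<open>b\<close> is its distance
          \<open>w i - b\<close> below \<open>w i\<close>.\<close>
        have "b \<in> (\<lambda>l. w i - l) ` {1..j}" if "w i - 1 \<ge> b" "b \<ge> w i - j" for b
          using that ge by (intro image_eqI[of _ _ "w i - b"]) auto
        then have "{b. w i - 1 \<ge> b \<and> b \<ge> w i - j} = (\<lambda>l. w i - l) ` {1..j}"
          using ge that by auto
        then show ?thesis
          by (simp only: Gs setcompr_eq_image image_image insert_commute[of i])
      qed
    qed
  }
qed

end
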